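(* Let $Q(\xi,y)=S(\xi)+q(\xi)\,yy^\top$, where $S(\xi)$ is a differentiable family of symmetric positive-definite $m\times m$ matrices, $q$ is a differentiable real function, and $y\in\mathbb R^m$, $y\neq0$, is fixed. Let primes denote derivatives with respect to $\xi$ at fixed $y$. Then the vertical derivative of the observed covariance along the fibre $y=\mathrm{const}$ is $Q'=S'+q'yy^\top$. It admits the decomposition, orthogonal for $\langle\cdot,\cdot\rangle_S$, $$Q'=\Big(\kappa+\frac{q'\rho^2}{m}\Big)S+\Big(\Pi^0_SS'+q'H_y\Big),$$ and consequently $$\|Q'\|_S^2=m\Big(\kappa+\frac{q'\rho^2}{m}\Big)^2+\big\|\Pi^0_SS'+q'H_y\big\|_S^2 .$$ Moreover, $$\|Q'\|_S\ge\Big[|q'|\rho^2\sqrt{\tfrac{m-1}{m}}-\sqrt2\,\chi_{\rm sh}\Big]_+,$$ and, more sharply, $$\|Q'\|_S\ge\left\{m\Big(\kappa+\frac{q'\rho^2}{m}\Big)^2+\Big[|q'|\rho^2\sqrt{\tfrac{m-1}{m}}-\sqrt2\,\chi_{\rm sh}\Big]_+^2\right\}^{1/2}.$$ Finally, complete first-order cancellation $Q'=0$ occurs if and only if $$\Pi^0_SS'=-q'H_y\qquad\text{and}\qquad \kappa=-\frac{q'\rho^2}{m}.$$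
   Context: Setting: $\xi$ is a scalar slow coordinate with diffusion coefficient $\sigma(\xi)>0$, the fast variable $Z\in\mathbb R^m$ has symmetric positive-definite diffusion covariance $D(\xi)$ with no slow–fast cross variation, and the observation is $Y=a(\xi)Z$ with $a>0$. Along the observation fibre $Y=y$ the observed quadratic covariance is $Q=S+q\,yy^\top$ with $S(\xi)=a(\xi)^2D(\xi)$ and $q(\xi)=\sigma(\xi)^2(a'(\xi)/a(\xi))^2$. At a symmetric positive-definite $S$, for symmetric matrices $H,K$ define $$\langle H,K\rangle_S=\operatorname{tr}(S^{-1}HS^{-1}K),\quad \|H\|_S^2=\langle H,H\rangle_S,\quad \Pi^0_SH=H-\frac{\operatorname{tr}(S^{-1}H)}{m}S .$$ Further, $$\kappa=\frac1m\operatorname{tr}(S^{-1}S'),\quad \chi_{\rm sh}=\frac1{\sqrt2}\|\Pi^0_SS'\|_S,\quad \rho^2=y^\top S^{-1}y,\quad H_y=yy^\top-\frac{\rho^2}{m}S,$$ and $[t]_+=\max(t,0)$. All quantities are evaluated at the same $\xi$. *)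

theory Defs
  imports "HOL-Analysis.Analysis"
begin

definition sym_posdef :: "real^'m^'m \<Rightarrow> bool" where
  "sym_posdef A \<longleftrightarrow> transpose A = A \<and> (\<forall>v. v \<noteq> 0 \<longrightarrow> v \<bullet> (A *v v) > 0)"

(* The rank-one matrix y y^T. *)
definition outer :: "real^'m \<Rightarrow> real^'m^'m" where
  "outer y = (columnvector y :: real^1^'m) ** rowvector y"

definition inner_at :: "real^'m^'m \<Rightarrow> real^'m^'m \<Rightarrow> real^'m^'m \<Rightarrow> real" where
  "inner_at S H K = trace (matrix_inv S ** H ** matrix_inv S ** K)"

(* inner_at S H H is nonnegative when S is symmetric positive definite and H is
   symmetric; these are the only arguments for which norm_at is intended. *)
definition norm_at :: "real^'m^'m \<Rightarrow> real^'m^'m \<Rightarrow> real" where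
  "norm_at S H = sqrt (inner_at S H H)"

definition tracefree_proj :: "real^'m^'m \<Rightarrow> real^'m^'m \<Rightarrow> real^'m^'m" where
  "tracefree_proj S H = H - (trace (matrix_inv S ** H) / real CARD('m)) *\<^sub>R S"

(* The square rho^2 itself; only rho^2 occurs. *)
definition rho_sq :: "real^'m^'m \<Rightarrow> real^'m \<Rightarrow> real" where
  "rho_sq S y = y \<bullet> (matrix_inv S *v y)"

definition H_mat :: "real^'m^'m \<Rightarrow> real^'m \<Rightarrow> real^'m^'m" where
  "H_mat S y = outer y - (rho_sq S y / real CARD('m)) *\<^sub>R S"

definition kappa :: "(real \<Rightarrow> real^'m^'m) \<Rightarrow> real \<Rightarrow> real" where
  "kappa S \<xi> = trace (matrix_inv (S \<xi>) ** vector_derivative S (at \<xi>)) / real CARD('m)"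

definition chi_sh :: "(real \<Rightarrow> real^'m^'m) \<Rightarrow> real \<Rightarrow> real" where
  "chi_sh S \<xi> = norm_at (S \<xi>) (tracefree_proj (S \<xi>) (vector_derivative S (at \<xi>))) / sqrt 2"

definition obs_cov ::
    "(real \<Rightarrow> real^'m^'m) \<Rightarrow> (real \<Rightarrow> real) \<Rightarrow> real \<Rightarrow> real^'m \<Rightarrow> real^'m^'m" where
  "obs_cov S q \<xi> y = S \<xi> + q \<xi> *\<^sub>R outer y"

definition vert_deriv :: "(real \<Rightarrow> real^'m \<Rightarrow> real^'m^'m) \<Rightarrow> real \<Rightarrow> real^'m \<Rightarrow> real^'m^'m" where
  "vert_deriv Q \<xi> y = vector_derivative (\<lambda>t. Q t y) (at \<xi>)"

definition pos_part :: "real \<Rightarrow> real" where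
  "pos_part t = max t 0"

end

theory Submission
  imports Defs
begin

text \<open>
  The geometry at a positive definite \<open>S\<close> is a disguised Frobenius geometry. Writing
  \<open>S\<^sup>-\<^sup>1 = U U\<^sup>T\<close>, cyclicity of the trace turns
  \<open>tr (S\<^sup>-\<^sup>1 H S\<^sup>-\<^sup>1 K)\<close> into the entrywise inner product of \<open>U\<^sup>T H U\<close> and
  \<open>U\<^sup>T K U\<close> whenever \<open>H\<close> is symmetric (\<open>inner_at_isometry\<close>). Hence Pythagoras and
  the triangle inequality are available for symmetric matrices, and every matrix in the
  statement is symmetric: for \<open>S'\<close> this is \<open>vector_derivative_symmetric\<close>.

  Since \<open>\<langle>S, K\<rangle>\<^sub>S = tr (S\<^sup>-\<^sup>1 K)\<close>, the trace-free part of a matrix is its component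
  orthogonal to \<open>S\<close>, and \<open>\<parallel>S\<parallel>\<^sup>2 = m\<close>. So \<open>Q'\<close> splits into a multiple of \<open>S\<close> and a part
  orthogonal to it, which gives the identity for \<open>\<parallel>Q'\<parallel>\<^sup>2\<close>. As
  \<open>\<parallel>yy\<^sup>T\<parallel> = \<rho>\<^sup>2\<close> and \<open>\<langle>S, yy\<^sup>T\<rangle>\<^sub>S = \<rho>\<^sup>2\<close>, the trace-free part \<open>H\<close> of \<open>yy\<^sup>T\<close>
  has \<open>\<parallel>H\<parallel>\<^sup>2 = \<rho>\<^sup>4 - \<rho>\<^sup>4 / m\<close>; the reverse triangle inequality bounds
  \<open>\<parallel>P + q' H\<parallel>\<close> below by \<open>\<bar>q'\<bar> \<parallel>H\<parallel> - \<parallel>P\<parallel>\<close>, and both lower bounds follow.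
  If \<open>Q' = 0\<close>, pairing with \<open>S\<close> kills the coefficient of \<open>S\<close>, and the rest must vanish.
\<close>

section \<open>Gram factorisation of positive semidefinite matrices\<close>

lemma outer_nth: "outer y $ i $ j = y $ i * y $ j"
  by (simp add: outer_def matrix_matrix_mult_def columnvector_def rowvector_def)

lemma outer_mult_vec: "outer w *v v = (w \<bullet> v) *\<^sub>R w"
  by (simp add: vec_eq_iff matrix_vector_mult_def outer_nth inner_vec_def
      sum_distrib_left sum_distrib_right mult_ac)

lemma transpose_outer: "transpose (outer y) = outer y"
  by (simp add: vec_eq_iff transpose_def outer_nth mult.commute)

lemma transpose_diff: "transpose (A - B) = transpose A - transpose (B :: real^'n^'m)"
  by (simp add: vec_eq_iff transpose_def)

lemma transpose_add: "transpose (A + B) = transpose A + transpose (B :: real^'n^'m)"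
  by (simp add: vec_eq_iff transpose_def)

lemma matrix_add_rdistrib: "(A + B) ** C = A ** C + B ** (C :: real^'n^'k)"
  by (simp add: vec_eq_iff matrix_matrix_mult_def distrib_right sum.distrib)

lemma inner_symmetric_matrix:
  fixes A :: "real^'m^'m"
  assumes "transpose A = A"
  shows "v \<bullet> (A *v w) = (A *v v) \<bullet> w"
  using assms by (metis dot_lmul_matrix vector_transpose_matrix)

text \<open>
  Pivoting on the diagonal entry \<open>c\<close> at index \<open>k\<close>, with column \<open>a\<close>, subtracts
  \<open>aa\<^sup>T / c\<close> and clears row \<open>k\<close>. What remains is still positive semidefinite: its value at
  \<open>v\<close> is the minimum of the original form over the line \<open>v + \<real> e\<^sub>k\<close>. So the set \<open>I\<close> of
  rows that may be nonzero shrinks by one each time.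
\<close>

lemma psd_supported_sum_outer:
  fixes A :: "real^'m^'m"
  assumes "finite I" "transpose A = A" "\<And>v. v \<bullet> (A *v v) \<ge> 0"
    and "\<And>i j. i \<notin> I \<Longrightarrow> A $ i $ j = 0"
  shows "\<exists>u :: 'm \<Rightarrow> real^'m. A = (\<Sum>k\<in>I. outer (u k))"
  using assms
proof (induction I arbitrary: A rule: finite_induct)
  case empty
  then show ?case by (simp add: vec_eq_iff)
next
  case (insert k I)
  define e :: "real^'m" where "e = axis k 1"
  define c where "c = A $ k $ k"
  define a where "a = A *v e"
  \<comment> \<open>If \<open>c = 0\<close> the division yields \<open>w = 0\<close>, which is right: the row is then already zero.\<close>
  define w where "w = (1 / sqrt c) *\<^sub>R a"
  define B where "B = A - outer w"
  have sym: "A $ i $ j = A $ j $ i" for i j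
    using insert.prems(1) by (metis transpose_def vec_lambda_beta)
  have a_nth: "a $ i = A $ i $ k" for i
    by (simp add: a_def e_def matrix_vector_mult_basis column_def)
  have e_a: "e \<bullet> a = c"
    by (simp add: e_def inner_axis' a_nth c_def)
  have c_nonneg: "c \<ge> 0"
    using insert.prems(2)[of e] by (simp add: a_def[symmetric] e_a)
  have form: "(v - s *\<^sub>R e) \<bullet> (A *v (v - s *\<^sub>R e)) = v \<bullet> (A *v v) - 2 * s * (v \<bullet> a) + s\<^sup>2 * c"
    for v s
  proof -
    have "e \<bullet> (A *v v) = v \<bullet> a"
      using inner_symmetric_matrix[OF insert.prems(1), of e v] by (simp add: a_def inner_commute)
    then show ?thesis
      by (simp add: matrix_vector_mult_diff_distrib matrix_vector_mult_scaleR
          a_def[symmetric] inner_diff_left inner_diff_right e_a power2_eq_square algebra_simps)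
  qed
  have degenerate: "v \<bullet> a = 0" if "c = 0" for v
  proof (rule ccontr)
    assume "v \<bullet> a \<noteq> 0"
    \<comment> \<open>With \<open>c = 0\<close> the form is affine along \<open>e\<close>; this step makes it equal to \<open>-1\<close>.\<close>
    define s where "s = (v \<bullet> (A *v v) + 1) / (2 * (v \<bullet> a))"
    have "2 * s * (v \<bullet> a) = v \<bullet> (A *v v) + 1"
      using \<open>v \<bullet> a \<noteq> 0\<close> by (simp add: s_def)
    then show False
      using form[of v s] insert.prems(2)[of "v - s *\<^sub>R e"] that by simp
  qed
  have "transpose B = B"
    by (simp add: B_def transpose_diff transpose_outer insert.prems(1))
  moreover have "v \<bullet> (B *v v) \<ge> 0" for v
  proof -
    have "v \<bullet> (B *v v) = v \<bullet> (A *v v) - (v \<bullet> w)\<^sup>2"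
      by (simp add: B_def matrix_vector_mult_diff_rdistrib outer_mult_vec inner_diff_right
          power2_eq_square inner_commute)
    also have "(v \<bullet> w)\<^sup>2 = (v \<bullet> a)\<^sup>2 / c"
      using c_nonneg by (simp add: w_def power_divide)
    also have "v \<bullet> (A *v v) - (v \<bullet> a)\<^sup>2 / c
        = (v - ((v \<bullet> a) / c) *\<^sub>R e) \<bullet> (A *v (v - ((v \<bullet> a) / c) *\<^sub>R e))"
      unfolding form by (cases "c = 0") (simp_all add: power2_eq_square)
    finally show ?thesis using insert.prems(2) by simp
  qed
  moreover have "B $ i $ j = 0" if "i \<notin> I" for i j
  proof (cases "i = k")
    case True
    have B_kj: "B $ k $ j = A $ k $ j - c * A $ j $ k / c"
      using c_nonneg by (simp add: B_def outer_nth w_def a_nth c_def[symmetric])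
    show ?thesis
    proof (cases "c = 0")
      case True
      then show ?thesis
        using B_kj degenerate[of "axis j 1"] sym[of k j] \<open>i = k\<close> by (simp add: inner_axis' a_nth)
    next
      case False
      then show ?thesis using B_kj sym[of k j] \<open>i = k\<close> by simp
    qed
  next
    case False
    then show ?thesis
      using that insert.prems(3)[of i] by (simp add: B_def outer_nth w_def a_nth)
  qed
  ultimately obtain u :: "'m \<Rightarrow> real^'m" where u: "B = (\<Sum>j\<in>I. outer (u j))"
    using insert.IH[of B] by blast
  have "(\<Sum>j\<in>I. outer ((u(k := w)) j)) = (\<Sum>j\<in>I. outer (u j))"
    using insert.hyps by (intro sum.cong) auto
  then have "A = (\<Sum>j\<in>insert k I. outer ((u(k := w)) j))"
    using u insert.hyps by (simp add: B_def algebra_simps)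
  then show ?case by blast
qed

lemma psd_gram_factorisation:
  fixes A :: "real^'m^'m"
  assumes "transpose A = A" "\<And>v. v \<bullet> (A *v v) \<ge> 0"
  obtains U :: "real^'m^'m" where "A = U ** transpose U"
proof -
  obtain u :: "'m \<Rightarrow> real^'m" where u: "A = (\<Sum>k\<in>UNIV. outer (u k))"
    using psd_supported_sum_outer[of UNIV A] assms by auto
  have "A = (\<chi> i k. u k $ i) ** transpose (\<chi> i k. u k $ i)"
    by (simp add: u vec_eq_iff matrix_matrix_mult_def transpose_def outer_nth)
  then show thesis by (rule that)
qed

section \<open>The inverse of a symmetric positive definite matrix\<close>

lemma sym_posdef_invertible:
  assumes "sym_posdef S"
  shows "invertible S"
proof -
  have "v = 0" if "S *v v = 0" for v
    using assms that unfolding sym_posdef_def by (metis inner_zero_right less_irrefl)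
  then show ?thesis
    by (simp add: invertible_left_inverse matrix_left_invertible_ker)
qed

lemma sym_posdef_inverse_mult:
  assumes "sym_posdef S"
  shows "S ** matrix_inv S = mat 1" "matrix_inv S ** S = mat 1"
  using sym_posdef_invertible[OF assms] unfolding invertible_def matrix_inv_def
  by (metis (mono_tags, lifting) someI_ex)+

lemma sym_posdef_inverse_symmetric:
  assumes "sym_posdef S"
  shows "transpose (matrix_inv S) = matrix_inv S"
proof -
  let ?A = "matrix_inv S"
  have "transpose ?A ** S = mat 1"
    using assms sym_posdef_inverse_mult(1)[OF assms]
    by (metis matrix_transpose_mul sym_posdef_def transpose_mat)
  then show ?thesis
    by (metis sym_posdef_inverse_mult(1)[OF assms] matrix_mul_assoc matrix_mul_lid matrix_mul_rid)
qed

lemma sym_posdef_inverse_psd: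
  assumes "sym_posdef S"
  shows "v \<bullet> (matrix_inv S *v v) \<ge> 0"
proof -
  let ?z = "matrix_inv S *v v"
  have "S *v ?z = v"
    by (simp add: matrix_vector_mul_assoc sym_posdef_inverse_mult[OF assms])
  moreover have "?z \<bullet> (S *v ?z) \<ge> 0"
    using assms unfolding sym_posdef_def by (cases "?z = 0") (auto intro: less_imp_le)
  ultimately show ?thesis by (simp add: inner_commute)
qed

section \<open>The inner product at a positive definite matrix\<close>

lemma trace_transpose_mult_eq_inner:
  fixes M N :: "real^'m^'m"
  shows "trace (transpose M ** N) = M \<bullet> N"
  unfolding trace_def matrix_matrix_mult_def transpose_def inner_vec_def
  by simp (rule sum.swap)

lemma inner_at_eq_congruence_inner:
  fixes S :: "real^'m^'m"
  assumes "matrix_inv S = U ** transpose U" "transpose H = H"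
  shows "inner_at S H K = (transpose U ** H ** U) \<bullet> (transpose U ** K ** U)"
proof -
  have "inner_at S H K = trace (U ** (transpose U ** H ** U ** transpose U ** K))"
    by (simp add: inner_at_def assms(1) matrix_mul_assoc)
  also have "\<dots> = trace ((transpose U ** H ** U) ** (transpose U ** K ** U))"
    by (subst trace_mul_sym) (simp add: matrix_mul_assoc)
  also have "transpose U ** H ** U = transpose (transpose U ** H ** U)"
    by (simp add: matrix_transpose_mul assms(2) matrix_mul_assoc)
  finally show ?thesis by (simp only: trace_transpose_mult_eq_inner transpose_transpose)
qed

text \<open>
  \<open>T\<close> is the congruence \<open>H \<mapsto> U\<^sup>T H U\<close> for a Gram factor \<open>U\<close> of \<open>S\<^sup>-\<^sup>1\<close>. Hiding \<open>U\<close>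
  leaves exactly what is needed to transport Euclidean norm inequalities.
\<close>

lemma inner_at_isometry:
  fixes S :: "real^'m^'m"
  assumes "sym_posdef S"
  obtains T :: "real^'m^'m \<Rightarrow> real^'m^'m"
  where "linear T" "\<And>H K. transpose H = H \<Longrightarrow> inner_at S H K = T H \<bullet> T K"
proof -
  obtain U :: "real^'m^'m" where U: "matrix_inv S = U ** transpose U"
    using psd_gram_factorisation[OF sym_posdef_inverse_symmetric[OF assms]
        sym_posdef_inverse_psd[OF assms]] by blast
  have "linear (\<lambda>H. transpose U ** H ** U)"
    by (rule linearI) (simp_all add: matrix_add_ldistrib
        matrix_add_rdistrib matrix_scalar_ac flip: scalar_matrix_assoc)
  then show thesis
    using that[of "\<lambda>H. transpose U ** H ** U"] inner_at_eq_congruence_inner[OF U] by blast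
qed

text \<open>Thus being trace-free relative to \<open>S\<close> means being orthogonal to \<open>S\<close>.\<close>

lemma inner_at_base_left:
  assumes "sym_posdef S"
  shows "inner_at S S K = trace (matrix_inv S ** K)"
  by (simp add: inner_at_def sym_posdef_inverse_mult[OF assms])

lemma trace_mult_outer: "trace (A ** outer y) = y \<bullet> (A *v y)"
  by (simp add: trace_def matrix_matrix_mult_def outer_nth inner_vec_def
      matrix_vector_mult_def sum_distrib_left mult_ac)

lemma inner_at_outer_outer: "inner_at S (outer y) (outer y) = (rho_sq S y)\<^sup>2"
proof -
  have "inner_at S (outer y) (outer y) = y \<bullet> (matrix_inv S *v (outer y *v (matrix_inv S *v y)))"
    by (simp add: inner_at_def trace_mult_outer matrix_vector_mul_assoc matrix_mul_assoc)
  then show ?thesis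
    by (simp add: outer_mult_vec matrix_vector_mult_scaleR rho_sq_def power2_eq_square)
qed

section \<open>Symmetry of the derivative of a symmetric family\<close>

lemma bounded_linear_transpose: "bounded_linear (transpose :: real^'n^'m \<Rightarrow> real^'m^'n)"
  unfolding linear_conv_bounded_linear[symmetric]
  by (rule linearI) (simp_all add: vec_eq_iff transpose_def)

text \<open>
  Near \<open>x\<close> the family coincides with its transpose, so both derivatives agree at \<open>x\<close>;
  \<open>X\<close> is open so that agreement on \<open>X\<close> is agreement near \<open>x\<close>.
\<close>

lemma vector_derivative_symmetric:
  fixes S :: "real \<Rightarrow> real^'m^'m"
  assumes "open X" "x \<in> X" "\<And>t. t \<in> X \<Longrightarrow> transpose (S t) = S t" "S differentiable (at x)"
  shows "transpose (vector_derivative S (at x)) = vector_derivative S (at x)"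
proof -
  have S': "(S has_vector_derivative vector_derivative S (at x)) (at x)"
    using assms(4) by (simp add: vector_derivative_works)
  then have "((\<lambda>t. transpose (S t)) has_vector_derivative transpose (vector_derivative S (at x))) (at x)"
    by (rule bounded_linear.has_vector_derivative[OF bounded_linear_transpose])
  then have "(S has_vector_derivative transpose (vector_derivative S (at x))) (at x)"
    by (rule has_vector_derivative_transform_within_open) (use assms in auto)
  then show ?thesis using S' by (rule vector_derivative_unique_at)
qed

section \<open>The vertical derivative of the observed covariance\<close>

theorem theorem8p1:
  fixes S :: "real \<Rightarrow> real^'m^'m" and q :: "real \<Rightarrow> real"
    and y :: "real^'m" and X :: "real set" and \<xi> :: real
  assumes "open X"
    and "\<And>x. x \<in> X \<Longrightarrow> sym_posdef (S x)"
    and "\<And>x. x \<in> X \<Longrightarrow> S differentiable (at x)"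
    and "\<And>x. x \<in> X \<Longrightarrow> q differentiable (at x)"
    and "y \<noteq> 0"
    and "\<xi> \<in> X"
  shows
    "let m = real CARD('m);
         S\<^sub>0 = S \<xi>;
         S' = vector_derivative S (at \<xi>);
         q' = deriv q \<xi>;
         Q' = vert_deriv (obs_cov S q) \<xi> y;
         \<rho>2 = rho_sq S\<^sub>0 y;
         k = kappa S \<xi>;
         chi = chi_sh S \<xi>;
         P = tracefree_proj S\<^sub>0 S';
         H = H_mat S\<^sub>0 y
     in
       (\<lambda>t. obs_cov S q t y) differentiable (at \<xi>) \<and>
       Q' = S' + q' *\<^sub>R outer y \<and>
       Q' = (k + q' * \<rho>2 / m) *\<^sub>R S\<^sub>0 + (P + q' *\<^sub>R H) \<and>
       inner_at S\<^sub>0 ((k + q' * \<rho>2 / m) *\<^sub>R S\<^sub>0) (P + q' *\<^sub>R H) = 0 \<and>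
       (norm_at S\<^sub>0 Q')\<^sup>2 = m * (k + q' * \<rho>2 / m)\<^sup>2 + (norm_at S\<^sub>0 (P + q' *\<^sub>R H))\<^sup>2 \<and>
       norm_at S\<^sub>0 Q' \<ge> pos_part (\<bar>q'\<bar> * \<rho>2 * sqrt ((m - 1) / m) - sqrt 2 * chi) \<and>
       norm_at S\<^sub>0 Q' \<ge>
         sqrt (m * (k + q' * \<rho>2 / m)\<^sup>2
               + (pos_part (\<bar>q'\<bar> * \<rho>2 * sqrt ((m - 1) / m) - sqrt 2 * chi))\<^sup>2) \<and>
       (Q' = 0 \<longleftrightarrow> P = - (q' *\<^sub>R H) \<and> k = - (q' * \<rho>2 / m))"
proof -
  define m where "m = real CARD('m)"
  define S0 where "S0 = S \<xi>"
  define S' where "S' = vector_derivative S (at \<xi>)"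
  define q' where "q' = deriv q \<xi>"
  define Q' where "Q' = vert_deriv (obs_cov S q) \<xi> y"
  define r where "r = rho_sq S0 y"
  define k where "k = kappa S \<xi>"
  define chi where "chi = chi_sh S \<xi>"
  define P where "P = tracefree_proj S0 S'"
  define H where "H = H_mat S0 y"
  define b where "b = k + q' * r / m"
  define d where "d = pos_part (\<bar>q'\<bar> * r * sqrt ((m - 1) / m) - sqrt 2 * chi)"

  have m_ge_1: "m \<ge> 1"
    by (simp add: m_def Suc_le_eq)
  have S0: "sym_posdef S0"
    using assms by (simp add: S0_def)
  have sym_S0: "transpose S0 = S0"
    using S0 by (simp add: sym_posdef_def)
  have sym_S': "transpose S' = S'"
    unfolding S'_def
    by (rule vector_derivative_symmetric[OF assms(1,6)])
      (use assms in \<open>auto simp: sym_posdef_def\<close>)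
  have r_nonneg: "r \<ge> 0"
    using sym_posdef_inverse_psd[OF S0] by (simp add: r_def rho_sq_def)

  have "(S has_vector_derivative S') (at \<xi>)"
    using assms by (simp add: S'_def vector_derivative_works)
  moreover have "(q has_real_derivative q') (at \<xi>)"
    using assms by (simp add: q'_def DERIV_deriv_iff_real_differentiable)
  ultimately have deriv_Q:
    "((\<lambda>t. obs_cov S q t y) has_vector_derivative S' + q' *\<^sub>R outer y) (at \<xi>)"
    unfolding obs_cov_def by (auto intro!: derivative_eq_intros)
  then have diff_Q: "(\<lambda>t. obs_cov S q t y) differentiable (at \<xi>)"
    by (rule differentiableI_vector)
  have Q'_eq: "Q' = S' + q' *\<^sub>R outer y"
    unfolding Q'_def vert_deriv_def by (rule vector_derivative_at[OF deriv_Q])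

  have P_eq: "P = S' - k *\<^sub>R S0"
    by (simp add: P_def k_def tracefree_proj_def kappa_def S0_def S'_def)
  have H_eq: "H = outer y - (r / m) *\<^sub>R S0"
    by (simp add: H_def H_mat_def r_def m_def)
  have decomp: "Q' = b *\<^sub>R S0 + (P + q' *\<^sub>R H)"
    by (simp add: Q'_eq P_eq H_eq b_def algebra_simps)

  obtain T :: "real^'m^'m \<Rightarrow> real^'m^'m" where T: "linear T"
    and inner_T: "\<And>H K. transpose H = H \<Longrightarrow> inner_at S0 H K = T H \<bullet> T K"
    using inner_at_isometry[OF S0] by blast
  have norm_T: "norm_at S0 K = norm (T K)" if "transpose K = K" for K
    using inner_T[OF that] by (simp add: norm_at_def norm_eq_sqrt_inner)
  note T_simps = linear_add[OF T] linear_diff[OF T] linear_cmul[OF T]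
  have sym_P: "transpose P = P" and sym_H: "transpose H = H"
    by (simp_all add: P_eq H_eq transpose_diff transpose_scalar sym_S0 sym_S' transpose_outer)
  have sym_PH: "transpose (P + q' *\<^sub>R H) = P + q' *\<^sub>R H"
    by (simp add: transpose_add transpose_scalar sym_P sym_H)
  have sym_Q': "transpose Q' = Q'"
    by (simp add: Q'_eq transpose_add transpose_scalar sym_S' transpose_outer)

  have T_S0: "T S0 \<bullet> T K = trace (matrix_inv S0 ** K)" for K
    using inner_T[OF sym_S0] inner_at_base_left[OF S0] by simp
  have S0_S0: "T S0 \<bullet> T S0 = m"
    by (simp add: T_S0 sym_posdef_inverse_mult[OF S0] trace_I m_def)
  have S0_P: "T S0 \<bullet> T P = 0"
  proof -
    have "T S0 \<bullet> T S' = m * k"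
      unfolding T_S0 by (simp add: k_def kappa_def S0_def S'_def m_def)
    then show ?thesis
      by (simp add: P_eq T_simps inner_diff_right S0_S0)
  qed
  have S0_outer: "T S0 \<bullet> T (outer y) = r"
    by (simp add: T_S0 trace_mult_outer r_def rho_sq_def)
  have S0_H: "T S0 \<bullet> T H = 0"
    using m_ge_1 by (simp add: H_eq T_simps inner_diff_right S0_S0 S0_outer)
  have S0_PH: "T S0 \<bullet> T (P + q' *\<^sub>R H) = 0"
    by (simp add: T_simps inner_add_right S0_P S0_H)
  have orth: "inner_at S0 (b *\<^sub>R S0) (P + q' *\<^sub>R H) = 0"
    using inner_T[of "b *\<^sub>R S0"] S0_PH by (simp add: transpose_scalar sym_S0 T_simps)

  have pyth: "(norm_at S0 Q')\<^sup>2 = m * b\<^sup>2 + (norm_at S0 (P + q' *\<^sub>R H))\<^sup>2"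
  proof -
    have "(norm_at S0 Q')\<^sup>2 = (norm (T Q'))\<^sup>2"
      by (simp add: norm_T sym_Q')
    also have "T Q' = b *\<^sub>R T S0 + T (P + q' *\<^sub>R H)"
      by (simp add: decomp T_simps)
    also have "(norm \<dots>)\<^sup>2 = (norm (b *\<^sub>R T S0))\<^sup>2 + (norm (T (P + q' *\<^sub>R H)))\<^sup>2"
      by (rule norm_add_Pythagorean) (simp add: orthogonal_def S0_PH)
    also have "(norm (b *\<^sub>R T S0))\<^sup>2 = m * b\<^sup>2"
      by (simp add: power_mult_distrib dot_square_norm[symmetric] S0_S0)
    finally show ?thesis by (simp add: norm_T sym_PH)
  qed

  have norm_H: "norm (T H) = r * sqrt ((m - 1) / m)"
  proof -
    have "T (outer y) \<bullet> T (outer y) = r\<^sup>2"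
      using inner_T[OF transpose_outer] inner_at_outer_outer[of S0 y] by (simp add: r_def)
    then have "T H \<bullet> T H = r\<^sup>2 * ((m - 1) / m)"
      using m_ge_1
      by (simp add: H_eq T_simps inner_diff_right inner_diff_left S0_S0 S0_outer
          inner_commute[of "T (outer y)" "T S0"] field_simps power2_eq_square)
    then show ?thesis
      using r_nonneg by (simp only: norm_eq_sqrt_inner real_sqrt_mult real_sqrt_abs abs_of_nonneg)
  qed
  have norm_P: "norm (T P) = sqrt 2 * chi"
    using norm_T[OF sym_P] by (simp add: chi_def chi_sh_def P_def S0_def S'_def)
  have "\<bar>q'\<bar> * r * sqrt ((m - 1) / m) - sqrt 2 * chi \<le> norm (T (P + q' *\<^sub>R H))"
    using norm_triangle_ineq4[of "T P + q' *\<^sub>R T H" "T P"]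
    by (simp add: T_simps norm_H norm_P abs_mult r_nonneg m_ge_1)
  then have d_le: "d \<le> norm_at S0 (P + q' *\<^sub>R H)"
    by (simp add: d_def pos_part_def norm_T sym_PH)
  have "sqrt (m * b\<^sup>2 + d\<^sup>2) \<le> sqrt ((norm_at S0 Q')\<^sup>2)"
    using d_le unfolding pyth by (simp add: power_mono d_def pos_part_def)
  then have sharp: "sqrt (m * b\<^sup>2 + d\<^sup>2) \<le> norm_at S0 Q'"
    by (simp add: norm_T sym_Q')
  have "d \<le> sqrt (m * b\<^sup>2 + d\<^sup>2)"
    using m_ge_1 by (intro real_le_rsqrt) simp
  then have coarse: "d \<le> norm_at S0 Q'"
    using sharp by linarith

  have cancel: "Q' = 0 \<longleftrightarrow> P = - (q' *\<^sub>R H) \<and> k = - (q' * r / m)"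
  proof
    assume "Q' = 0"
    then have "T S0 \<bullet> T (b *\<^sub>R S0 + (P + q' *\<^sub>R H)) = 0"
      by (simp flip: decomp add: linear_0[OF T])
    then have "b * m = 0"
      using S0_PH by (simp add: linear_add[OF T, of "b *\<^sub>R S0"] linear_cmul[OF T]
          inner_add_right S0_S0)
    then have "b = 0"
      using m_ge_1 by simp
    then show "P = - (q' *\<^sub>R H) \<and> k = - (q' * r / m)"
      using \<open>Q' = 0\<close> decomp by (simp add: b_def eq_neg_iff_add_eq_0)
  next
    assume "P = - (q' *\<^sub>R H) \<and> k = - (q' * r / m)"
    then show "Q' = 0"
      by (simp add: decomp b_def)
  qed

  show ?thesis
    unfolding Let_def
    using diff_Q Q'_eq decomp orth pyth coarse sharp cancel
    unfolding b_def d_def Q'_def P_def H_def k_def chi_def r_def q'_def S'_def S0_def m_def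
    by blast
qed

end
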